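(* Let $(L,\mathcal G)$ be a stable nestoid, let $f\in\mathcal G$, and consider the two sets $$\mathcal G^{\lceil f\rceil}:=\{g\in\mathcal G\mid g\le f\}\qquad\text{and}\qquad\mathcal G^{\lfloor f\rfloor}:=\{g\in\mathcal G\mid g>f\text{ or }g\vee f\notin\mathcal G\}.$$ Then both $([\hat 0,f],\mathcal G^{\lceil f\rceil})$ and $(L,\mathcal G^{\lfloor f\rfloor})$ are stable nestoids, and there is an isomorphism (of posets ordered by inclusion) $$\mathcal N(L,\mathcal G)_{\ni f}\simeq\mathcal N([\hat 0,f],\mathcal G^{\lceil f\rceil})_{\ni f}\times\mathcal N(L,\mathcal G^{\lfloor f\rfloor}),$$ where the subscript $\ni f$ denotes the subset of nested sets containing $f$.
   Context: All lattices are finite. Let $L$ be a lattice with minimum $\hat 0$ and maximum $\hat 1$. A subset $\mathcal G\subseteq L_{>\hat 0}$ is nestable if $\hat 1\in\mathcal G$ and for any two incomparable $f,g\in\mathcal G$, $f\vee g\notin\mathcal G$ implies $f\wedge g=\hat 0$. A subset $N\subseteq\mathcal G$ is nested if for all $k\ge 2$ and pairwise incomparable $f_1,\dots,f_k\in N$ one has $f_1\vee\dots\vee f_k\notin\mathcal G$. $\mathcal N(L,\mathcal G)$ is the simplicial complex of nested sets (including the empty one). $(L,\mathcal G)$ is a nestoid if $\mathcal G$ is nestable and for every $f\in\mathcal G$ the complex $\mathcal N([\hat 0,f],\mathcal G\cap[\hat 0,f])$ is pure. A nestoid is stable if for all $f,g_1,\dots,g_k\in\mathcal G$ with $f\vee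 g_i\notin\mathcal G$ for all $i$ one has $f\vee g_1\vee\dots\vee g_k\notin\mathcal G$.
   Formalization: The claim that (L, G^⌊f⌋) is a stable nestoid is stated only for f ≠ 1̂, because for f = 1̂ the set G^⌊f⌋ is empty, so it does not contain 1̂ and is not nestable; the other two conclusions are stated for all f in G. *)

theory Defs
  imports "HOL-Algebra.Lattice" "HOL-Library.Product_Order"
begin

locale finite_bounded_lattice = bounded_lattice +
  assumes finite_carrier: "finite (carrier L)"

definition incomparable :: "('a, 'b) gorder_scheme \<Rightarrow> 'a \<Rightarrow> 'a \<Rightarrow> bool" where
  "incomparable L x y \<longleftrightarrow> \<not> x \<sqsubseteq>\<^bsub>L\<^esub> y \<and> \<not> y \<sqsubseteq>\<^bsub>L\<^esub> x"

definition nestable :: "('a, 'b) gorder_scheme \<Rightarrow> 'a set \<Rightarrow> bool" where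
  "nestable L G \<longleftrightarrow>
     G \<subseteq> carrier L - {\<bottom>\<^bsub>L\<^esub>} \<and> \<top>\<^bsub>L\<^esub> \<in> G \<and>
     (\<forall>f\<in>G. \<forall>g\<in>G. incomparable L f g \<longrightarrow> f \<squnion>\<^bsub>L\<^esub> g \<notin> G \<longrightarrow> f \<sqinter>\<^bsub>L\<^esub> g = \<bottom>\<^bsub>L\<^esub>)"

text \<open>Pairwise incomparable elements \<open>f\<^sub>1, \<dots>, f\<^sub>k\<close> are distinct, so such a family is the same
  as a finite set \<open>F\<close> of cardinality \<open>k\<close>; the condition \<open>card F \<ge> 2\<close> includes finiteness.\<close>

definition nested :: "('a, 'b) gorder_scheme \<Rightarrow> 'a set \<Rightarrow> 'a set \<Rightarrow> bool" where
  "nested L G N \<longleftrightarrow>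
     N \<subseteq> G \<and>
     (\<forall>F\<subseteq>N. card F \<ge> 2 \<longrightarrow> pairwise (incomparable L) F \<longrightarrow> \<Squnion>\<^bsub>L\<^esub>F \<notin> G)"

definition nested_complex :: "('a, 'b) gorder_scheme \<Rightarrow> 'a set \<Rightarrow> 'a set set" where
  "nested_complex L G = {N. nested L G N}"

definition pure_complex :: "'a set set \<Rightarrow> bool" where
  "pure_complex K \<longleftrightarrow>
     (\<forall>S T. S \<in> K \<and> (\<forall>S'\<in>K. S \<subseteq> S' \<longrightarrow> S' = S) \<longrightarrow>
            T \<in> K \<and> (\<forall>T'\<in>K. T \<subseteq> T' \<longrightarrow> T' = T) \<longrightarrow> card S = card T)"

abbreviation lower_interval :: "('a, 'b) gorder_scheme \<Rightarrow> 'a \<Rightarrow> ('a, 'b) gorder_scheme" where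
  "lower_interval L f \<equiv> L\<lparr>carrier := \<lbrace>\<bottom>\<^bsub>L\<^esub>..f\<rbrace>\<^bsub>L\<^esub>\<rparr>"

definition nestoid :: "('a, 'b) gorder_scheme \<Rightarrow> 'a set \<Rightarrow> bool" where
  "nestoid L G \<longleftrightarrow>
     finite_bounded_lattice L \<and> nestable L G \<and>
     (\<forall>f\<in>G. pure_complex (nested_complex (lower_interval L f) (G \<inter> \<lbrace>\<bottom>\<^bsub>L\<^esub>..f\<rbrace>\<^bsub>L\<^esub>)))"

text \<open>The set \<open>A\<close> below is the set of the \<open>g\<^sub>1, \<dots>, g\<^sub>k\<close>; here \<open>k \<ge> 1\<close>, since the case
  \<open>k = 0\<close> would assert \<open>f \<notin> G\<close>.\<close>

definition stable_nestoid :: "('a, 'b) gorder_scheme \<Rightarrow> 'a set \<Rightarrow> bool" where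
  "stable_nestoid L G \<longleftrightarrow>
     nestoid L G \<and>
     (\<forall>f\<in>G. \<forall>A\<subseteq>G. A \<noteq> {} \<longrightarrow> (\<forall>g\<in>A. f \<squnion>\<^bsub>L\<^esub> g \<notin> G) \<longrightarrow> \<Squnion>\<^bsub>L\<^esub>(insert f A) \<notin> G)"

definition G_ceil :: "('a, 'b) gorder_scheme \<Rightarrow> 'a set \<Rightarrow> 'a \<Rightarrow> 'a set" where
  "G_ceil L G f = {g \<in> G. g \<sqsubseteq>\<^bsub>L\<^esub> f}"

text \<open>For \<open>f = \<top>\<close> the following set is empty, as \<open>g \<squnion> \<top> = \<top> \<in> G\<close> for all \<open>g\<close>; in particular it does
  not contain \<open>\<top>\<close> and hence is not nestable.\<close>

definition G_floor :: "('a, 'b) gorder_scheme \<Rightarrow> 'a set \<Rightarrow> 'a \<Rightarrow> 'a set" where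
  "G_floor L G f = {g \<in> G. f \<sqsubset>\<^bsub>L\<^esub> g \<or> g \<squnion>\<^bsub>L\<^esub> f \<notin> G}"

text \<open>On sets, \<open>\<le>\<close> is inclusion; on pairs it is the componentwise order.\<close>

definition poset_isomorphic :: "'a::order set \<Rightarrow> 'b::order set \<Rightarrow> bool" where
  "poset_isomorphic P Q \<longleftrightarrow>
     (\<exists>\<phi>. bij_betw \<phi> P Q \<and> (\<forall>x\<in>P. \<forall>y\<in>P. x \<le> y \<longleftrightarrow> \<phi> x \<le> \<phi> y))"

end

theory Submission
  imports Defs
begin

text \<open>Stability turns nestedness into a condition on pairs. Call two elements compatible if they are
  comparable or their join lies outside \<open>G\<close>. If \<open>F\<close> is an antichain of pairwise compatible members
  of \<open>G\<close> and \<open>x \<in> F\<close>, then stability applied to \<open>x\<close> and the other elements of \<open>F\<close> shows that the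
  join of \<open>F\<close> is not in \<open>G\<close>. Hence the nested complex is the clique complex of the compatibility
  graph (\<open>nested_complex_eq_cliques\<close>), and the theorem becomes a statement about the neighbours of
  the vertex \<open>f\<close>.

  Apart from \<open>f\<close> itself, the members of \<open>G\<close> compatible with \<open>f\<close> are those below \<open>f\<close> and those of
  the floor family. The decomposition rests on two facts. Each member of \<open>G\<close> below \<open>f\<close> is
  compatible with each member of the floor family (\<open>ceil_floor_compatible\<close>), because members of \<open>G\<close>
  with a common lower bound in \<open>G\<close> have their join in \<open>G\<close>. And the floor family contains the join of
  two of its members as soon as \<open>G\<close> does (\<open>floor_joins\<close>), so that passing to it changes neither
  stability nor compatibility. Thus a clique containing \<open>f\<close> is the union of a clique below \<open>f\<close>
  containing \<open>f\<close> and an arbitrary clique of the floor family (\<open>star_isomorphic\<close>).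

  The ceiling family inherits its properties because joins, meets and intervals in \<open>[\<bottom>, f]\<close> are
  those of \<open>L\<close>. For purity of the floor family, let \<open>g\<close> be one of its members. If \<open>g\<close> lies above
  \<open>f\<close>, the same product decomposition inside \<open>[\<bottom>, g]\<close> exhibits the complex of the floor family as
  a factor of a pure one: adding a fixed facet below \<open>f\<close> turns its facets into facets of the large
  complex and shifts all cardinalities by the same amount (\<open>pure_factor\<close>). Otherwise
  \<open>f \<squnion> g \<notin> G\<close>, and then \<open>G\<close> and the floor family agree on \<open>[\<bottom>, g]\<close>.\<close>

section \<open>Clique complexes\<close>

definition cliques :: "'a set \<Rightarrow> ('a \<Rightarrow> 'a \<Rightarrow> bool) \<Rightarrow> 'a set set" where
  "cliques V R = {N. N \<subseteq> V \<and> pairwise R N}"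

lemma cliques_cong:
  assumes "\<And>x y. x \<in> V \<Longrightarrow> y \<in> V \<Longrightarrow> R x y = R' x y"
  shows "cliques V R = cliques V R'"
proof -
  have "pairwise R N = pairwise R' N" if "N \<subseteq> V" for N
    using that assms unfolding pairwise_def by (meson subsetD)
  then show ?thesis
    unfolding cliques_def by blast
qed

definition facet :: "'a set set \<Rightarrow> 'a set \<Rightarrow> bool" where
  "facet K S \<longleftrightarrow> S \<in> K \<and> (\<forall>S'\<in>K. S \<subseteq> S' \<longrightarrow> S' = S)"

lemma pure_complex_iff_facets:
  "pure_complex K \<longleftrightarrow> (\<forall>S T. facet K S \<longrightarrow> facet K T \<longrightarrow> card S = card T)"
  unfolding pure_complex_def facet_def ..

text \<open>A vertex \<open>f\<close> of a graph whose neighbours all lie in one of two disjoint vertex sets \<open>A \<ni> f\<close> and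
  \<open>B\<close>, between which all edges are present. On the level of clique complexes this makes the star of
  \<open>f\<close> a join of the star of \<open>f\<close> within \<open>A\<close> and the complex on \<open>B\<close>.\<close>

locale vertex_link_join =
  fixes R :: "'a \<Rightarrow> 'a \<Rightarrow> bool" and V A B :: "'a set" and f :: 'a
  assumes sym: "\<And>x y. R x y \<Longrightarrow> R y x"
    and parts: "A \<subseteq> V" "B \<subseteq> V" "A \<inter> B = {}"
    and vertex: "f \<in> A"
    and neighbours: "\<And>x. x \<in> V \<Longrightarrow> x \<noteq> f \<Longrightarrow> R f x \<Longrightarrow> x \<in> A \<union> B"
    and joined: "\<And>a b. a \<in> A \<Longrightarrow> b \<in> B \<Longrightarrow> R a b"
begin

lemma clique_union:
  assumes "S \<in> cliques A R" "T \<in> cliques B R"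
  shows "S \<union> T \<in> cliques V R"
proof -
  have "S \<subseteq> A" "T \<subseteq> B" "pairwise R S" "pairwise R T"
    using assms unfolding cliques_def by auto
  moreover from this have "R s t \<and> R t s" if "s \<in> S" "t \<in> T" for s t
    using that joined sym by blast
  ultimately show ?thesis
    using parts(1,2) unfolding cliques_def by (auto simp: pairwise_def)
qed

lemma clique_split:
  assumes "N \<in> cliques V R" "f \<in> N"
  shows "N \<inter> A \<in> cliques A R" "N \<inter> B \<in> cliques B R" "N = (N \<inter> A) \<union> (N \<inter> B)"
proof -
  show "N \<inter> A \<in> cliques A R" "N \<inter> B \<in> cliques B R"
    using assms unfolding cliques_def by (auto intro: pairwise_subset)
  show "N = (N \<inter> A) \<union> (N \<inter> B)"
  proof -
    have "N \<subseteq> V" "pairwise R N"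
      using assms(1) unfolding cliques_def by auto
    then have "x \<in> A \<union> B" if "x \<in> N" for x
      using that assms(2) neighbours[of x] vertex by (cases "x = f") (auto simp: pairwise_def)
    then show ?thesis
      by blast
  qed
qed

lemma star_isomorphic:
  "poset_isomorphic {N \<in> cliques V R. f \<in> N} ({N \<in> cliques A R. f \<in> N} \<times> cliques B R)"
  (is "poset_isomorphic ?P ?Q")
proof -
  let ?\<phi> = "\<lambda>N. (N \<inter> A, N \<inter> B)"
  have restrict: "(S \<union> T) \<inter> A = S" "(S \<union> T) \<inter> B = T"
    if "S \<in> cliques A R" "T \<in> cliques B R" for S T
    using that parts(3) unfolding cliques_def by auto
  have "bij_betw ?\<phi> ?P ?Q"
  proof (rule bij_betw_byWitness[where f' = "\<lambda>(S, T). S \<union> T"])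
    show "\<forall>N\<in>?P. (\<lambda>(S, T). S \<union> T) (?\<phi> N) = N"
      using clique_split(3) by auto
    show "\<forall>p\<in>?Q. ?\<phi> ((\<lambda>(S, T). S \<union> T) p) = p"
      using restrict by auto
    show "?\<phi> ` ?P \<subseteq> ?Q"
      using clique_split(1,2) vertex by auto
    show "(\<lambda>(S, T). S \<union> T) ` ?Q \<subseteq> ?P"
      using clique_union by auto
  qed
  moreover have "M \<subseteq> N \<longleftrightarrow> ?\<phi> M \<le> ?\<phi> N" if "M \<in> ?P" "N \<in> ?P" for M N
    using clique_split(3)[of M] clique_split(3)[of N] that by auto
  ultimately show ?thesis
    unfolding poset_isomorphic_def by blast
qed

text \<open>A maximal clique of \<open>B\<close>, enlarged by a fixed maximal clique of \<open>A\<close> through \<open>f\<close>, is maximal in the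
  whole graph: any larger clique contains \<open>f\<close>, hence splits into its parts in \<open>A\<close> and \<open>B\<close>, neither of
  which can grow. Its cardinality exceeds that of the clique in \<open>B\<close> by a constant.\<close>

lemma pure_factor:
  assumes finV: "finite V" and pure: "pure_complex (cliques V R)"
  shows "pure_complex (cliques B R)"
proof -
  have "{f} \<in> {N \<in> cliques A R. f \<in> N}"
    using vertex by (auto simp: cliques_def)
  moreover have "finite {N \<in> cliques A R. f \<in> N}"
    using finV parts(1) by (auto simp: cliques_def intro: finite_subset[of _ "Pow V"])
  ultimately obtain M where M: "M \<in> cliques A R" "f \<in> M"
    and Mmax: "\<And>M'. M' \<in> cliques A R \<Longrightarrow> f \<in> M' \<Longrightarrow> M \<subseteq> M' \<Longrightarrow> M' = M"
    using finite_has_maximal[of "{N \<in> cliques A R. f \<in> N}"] by auto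
  have extend: "facet (cliques V R) (M \<union> S)" and card: "card (M \<union> S) = card M + card S"
    if S: "facet (cliques B R) S" for S
  proof -
    have SB: "S \<in> cliques B R"
      using S unfolding facet_def by blast
    have MA: "M \<subseteq> A" and SinB: "S \<subseteq> B"
      using M(1) SB unfolding cliques_def by auto
    have "T = M \<union> S" if T: "T \<in> cliques V R" "M \<union> S \<subseteq> T" for T
    proof -
      have fT: "f \<in> T"
        using M(2) T(2) by blast
      have "T \<inter> A = M"
        using clique_split(1)[OF T(1) fT] fT vertex T(2) MA by (intro Mmax) auto
      moreover have "S \<subseteq> T \<inter> B"
        using T(2) SinB by blast
      then have "T \<inter> B = S"
        using S clique_split(2)[OF T(1) fT] by (simp add: facet_def)
      ultimately show ?thesis
        using clique_split(3)[OF T(1) fT] by simp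
    qed
    then show "facet (cliques V R) (M \<union> S)"
      using clique_union[OF M(1) SB] unfolding facet_def by blast
    have "finite M" "finite S"
      using MA SinB parts(1,2) finite_subset[OF _ finV] by auto
    moreover have "M \<inter> S = {}"
      using MA SinB parts(3) by blast
    ultimately show "card (M \<union> S) = card M + card S"
      by (rule card_Un_disjoint)
  qed
  have "card S = card T" if "facet (cliques B R) S" "facet (cliques B R) T" for S T
  proof -
    have "card (M \<union> S) = card (M \<union> T)"
      using pure extend[OF that(1)] extend[OF that(2)] unfolding pure_complex_iff_facets by blast
    then show ?thesis
      using card[OF that(1)] card[OF that(2)] by simp
  qed
  then show ?thesis
    unfolding pure_complex_iff_facets by blast
qed

end

section \<open>Lower intervals of a finite lattice\<close>

context finite_bounded_lattice
begin

lemma mem_lower_interval: "x \<in> \<lbrace>\<bottom>..g\<rbrace> \<longleftrightarrow> x \<in> carrier L \<and> x \<sqsubseteq> g"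
  by (auto simp: at_least_at_most_def)

lemma sup_least_upper:
  assumes "A \<subseteq> carrier L" "A \<noteq> {}"
  shows "\<Squnion>A \<in> carrier L" "\<And>a. a \<in> A \<Longrightarrow> a \<sqsubseteq> \<Squnion>A"
    "\<And>u. u \<in> carrier L \<Longrightarrow> (\<And>a. a \<in> A \<Longrightarrow> a \<sqsubseteq> u) \<Longrightarrow> \<Squnion>A \<sqsubseteq> u"
proof -
  have "finite A"
    using assms(1) finite_carrier by (rule finite_subset)
  then have lub: "least L (\<Squnion>A) (Upper L A)"
    using assms by (rule finite_sup_least)
  then show "\<Squnion>A \<in> carrier L"
    by simp
  show "a \<sqsubseteq> \<Squnion>A" if "a \<in> A" for a
    using least_Upper_above[OF lub that assms(1)] .
  show "\<Squnion>A \<sqsubseteq> u" if "u \<in> carrier L" "\<And>a. a \<in> A \<Longrightarrow> a \<sqsubseteq> u" for u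
  proof (rule least_le[OF lub])
    show "u \<in> Upper L A"
      using that by (auto simp: Upper_def)
  qed
qed

lemma partial_order_interval: "partial_order (lower_interval L g)"
proof -
  interpret I: weak_partial_order "lower_interval L g"
    using weak_partial_order_axioms at_least_at_most_closed by (rule weak_partial_order_subset)
  show ?thesis
    by unfold_locales (simp add: eq_is_equal)
qed

text \<open>Suprema and infima are chosen by Hilbert's operator from the bounds within the carrier, so it takes
  an argument that shrinking the carrier to an interval preserves those of nonempty finite sets: the element chosen in \<open>L\<close>
  lies in the interval and is still extremal there, and such an element is unique.\<close>

lemma lub_interval:
  assumes "A \<subseteq> \<lbrace>\<bottom>..g\<rbrace>" "A \<noteq> {}" "g \<in> carrier L"
  shows "least (lower_interval L g) (\<Squnion>A) (Upper (lower_interval L g) A)"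
proof -
  have A: "A \<subseteq> carrier L" "\<And>a. a \<in> A \<Longrightarrow> a \<sqsubseteq> g"
    using assms(1) by (auto simp: mem_lower_interval)
  note lub = sup_least_upper[OF A(1) assms(2)]
  show ?thesis
  proof (rule least_UpperI)
    show "\<Squnion>A \<sqsubseteq>\<^bsub>lower_interval L g\<^esub> u" if "u \<in> Upper (lower_interval L g) A" for u
    proof -
      have "u \<in> carrier L" "a \<sqsubseteq> u" if "a \<in> A" for a
        using that \<open>u \<in> _\<close> assms(1) by (auto simp: Upper_def mem_lower_interval)
      then show ?thesis
        using lub(3)[of u] assms(2) by auto
    qed
  qed (use assms A lub in \<open>auto simp: mem_lower_interval\<close>)
qed

lemma sup_interval:
  assumes "A \<subseteq> \<lbrace>\<bottom>..g\<rbrace>" "A \<noteq> {}" "g \<in> carrier L"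
  shows "\<Squnion>\<^bsub>lower_interval L g\<^esub>A = \<Squnion>A"
proof -
  interpret I: partial_order "lower_interval L g"
    by (rule partial_order_interval)
  show ?thesis
    unfolding Lattice.sup_def[of "lower_interval L g"]
    using lub_interval[OF assms] by (blast intro: some_equality I.least_unique)
qed

lemma join_interval:
  assumes "x \<in> \<lbrace>\<bottom>..g\<rbrace>" "y \<in> \<lbrace>\<bottom>..g\<rbrace>" "g \<in> carrier L"
  shows "x \<squnion>\<^bsub>lower_interval L g\<^esub> y = x \<squnion> y"
  using assms by (simp add: join_def sup_interval)

lemma glb_interval:
  assumes "x \<in> \<lbrace>\<bottom>..g\<rbrace>" "y \<in> \<lbrace>\<bottom>..g\<rbrace>" "g \<in> carrier L"
  shows "greatest (lower_interval L g) (x \<sqinter> y) (Lower (lower_interval L g) {x, y})"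
proof -
  have xy: "x \<in> carrier L" "y \<in> carrier L" "x \<sqsubseteq> g"
    using assms by (auto simp: mem_lower_interval)
  then have "x \<sqinter> y \<sqsubseteq> g"
    using assms(3) meet_left meet_closed le_trans by metis
  then show ?thesis
    using xy assms meet_left meet_right
    by (intro greatest_LowerI) (auto simp: Lower_def mem_lower_interval intro: meet_le)
qed

lemma meet_interval:
  assumes "x \<in> \<lbrace>\<bottom>..g\<rbrace>" "y \<in> \<lbrace>\<bottom>..g\<rbrace>" "g \<in> carrier L"
  shows "x \<sqinter>\<^bsub>lower_interval L g\<^esub> y = x \<sqinter> y"
proof -
  interpret I: partial_order "lower_interval L g"
    by (rule partial_order_interval)
  show ?thesis
    unfolding meet_def[of "lower_interval L g"] Lattice.inf_def[of "lower_interval L g"]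
    using glb_interval[OF assms] by (blast intro: some_equality I.greatest_unique)
qed

lemma finite_bounded_lattice_interval:
  assumes g: "g \<in> carrier L"
  shows "finite_bounded_lattice (lower_interval L g)"
proof -
  interpret I: partial_order "lower_interval L g"
    by (rule partial_order_interval)
  show ?thesis
  proof unfold_locales
    fix x y assume "x \<in> carrier (lower_interval L g)" "y \<in> carrier (lower_interval L g)"
    then have xy: "x \<in> \<lbrace>\<bottom>..g\<rbrace>" "y \<in> \<lbrace>\<bottom>..g\<rbrace>"
      by simp_all
    show "\<exists>s. least (lower_interval L g) s (Upper (lower_interval L g) {x, y})"
      using lub_interval[of "{x, y}", OF _ _ g] xy by blast
    show "\<exists>s. greatest (lower_interval L g) s (Lower (lower_interval L g) {x, y})"
      using glb_interval[OF xy g] by blast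
  next
    show "\<exists>x. least (lower_interval L g) x (carrier (lower_interval L g))"
      using g by (intro exI[of _ \<bottom>]) (auto simp: least_def mem_lower_interval)
    show "\<exists>x. greatest (lower_interval L g) x (carrier (lower_interval L g))"
      using g by (intro exI[of _ g]) (auto simp: greatest_def mem_lower_interval)
    show "finite (carrier (lower_interval L g))"
      using finite_carrier by (auto simp: at_least_at_most_def)
  qed
qed

lemma bounds_interval:
  assumes g: "g \<in> carrier L"
  shows "\<bottom>\<^bsub>lower_interval L g\<^esub> = \<bottom>" "\<top>\<^bsub>lower_interval L g\<^esub> = g"
proof -
  interpret I: finite_bounded_lattice "lower_interval L g"
    using g by (rule finite_bounded_lattice_interval)
  show "\<bottom>\<^bsub>lower_interval L g\<^esub> = \<bottom>"
    using g I.bottom_eq[of \<bottom>] by (simp add: mem_lower_interval)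
  show "\<top>\<^bsub>lower_interval L g\<^esub> = g"
    using g I.top_eq[of g] by (simp add: mem_lower_interval)
qed

lemma interval_of_interval:
  assumes "g \<in> carrier L" "h \<in> carrier L" "h \<sqsubseteq> g"
  shows "\<lbrace>\<bottom>\<^bsub>lower_interval L g\<^esub>..h\<rbrace>\<^bsub>lower_interval L g\<^esub> = \<lbrace>\<bottom>..h\<rbrace>"
  using assms le_trans[of _ h g] bounds_interval(1)[OF assms(1)]
  by (auto simp: mem_lower_interval at_least_at_most_def[of "lower_interval L g"])

end

section \<open>Stable families and compatibility\<close>

definition compatible :: "('a, 'b) gorder_scheme \<Rightarrow> 'a set \<Rightarrow> 'a \<Rightarrow> 'a \<Rightarrow> bool" where
  "compatible L G x y \<longleftrightarrow> (incomparable L x y \<longrightarrow> x \<squnion>\<^bsub>L\<^esub> y \<notin> G)"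

lemma compatible_sym: "compatible L G x y \<Longrightarrow> compatible L G y x"
  unfolding compatible_def incomparable_def by (simp add: join_comm)

text \<open>Stability is separated from the other axioms of a stable nestoid since it passes to lower intervals
  and to the floor family in all cases. In particular the floor family of \<open>\<top>\<close>, which is empty and
  therefore not nestable, is still a stable family.\<close>

locale stable_family = finite_bounded_lattice +
  fixes G
  assumes family_closed: "G \<subseteq> carrier L"
    and stable: "f \<in> G \<Longrightarrow> A \<subseteq> G \<Longrightarrow> A \<noteq> {} \<Longrightarrow> (\<And>g. g \<in> A \<Longrightarrow> f \<squnion> g \<notin> G) \<Longrightarrow>
      \<Squnion>(insert f A) \<notin> G"
begin

text \<open>Stability, with one element of an antichain as the distinguished element, propagates the condition
  on pairs to the join of the whole antichain.\<close>

lemma nested_complex_eq_cliques: "nested_complex L G = cliques G (compatible L G)"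
proof -
  have "pairwise (compatible L G) N" if N: "nested L G N" for N
  proof (rule pairwiseI)
    fix x y assume xy: "x \<in> N" "y \<in> N" "x \<noteq> y"
    show "compatible L G x y"
      unfolding compatible_def
    proof
      assume "incomparable L x y"
      then have "pairwise (incomparable L) {x, y}"
        by (auto simp: pairwise_def incomparable_def)
      moreover have "card {x, y} \<ge> 2" "{x, y} \<subseteq> N"
        using xy by auto
      ultimately show "x \<squnion> y \<notin> G"
        using N unfolding nested_def join_def by blast
    qed
  qed
  moreover have "\<Squnion>F \<notin> G"
    if N: "N \<subseteq> G" "pairwise (compatible L G) N"
      and F: "F \<subseteq> N" "card F \<ge> 2" "pairwise (incomparable L) F" for N F
  proof -
    obtain x where x: "x \<in> F"
      using F(2) by fastforce
    have rest: "F - {x} \<noteq> {}"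
    proof
      assume "F - {x} = {}"
      with x have "F = {x}" by blast
      with F(2) show False by simp
    qed
    have "x \<squnion> g \<notin> G" if "g \<in> F - {x}" for g
    proof -
      have "compatible L G x g" "incomparable L x g"
        using that x pairwise_subset[OF N(2) F(1)] F(3) by (auto simp: pairwise_def)
      then show ?thesis
        by (simp add: compatible_def)
    qed
    then have "\<Squnion>(insert x (F - {x})) \<notin> G"
      using N(1) F(1) x rest by (intro stable) auto
    then show ?thesis
      using x by (simp add: insert_absorb)
  qed
  ultimately show ?thesis
    unfolding nested_complex_def cliques_def by (auto simp: nested_def)
qed

lemma stable_family_interval:
  assumes g: "g \<in> carrier L"
  shows "stable_family (lower_interval L g) (G \<inter> \<lbrace>\<bottom>..g\<rbrace>)"
proof -
  interpret I: finite_bounded_lattice "lower_interval L g"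
    using g by (rule finite_bounded_lattice_interval)
  show ?thesis
  proof unfold_locales
    show "G \<inter> \<lbrace>\<bottom>..g\<rbrace> \<subseteq> carrier (lower_interval L g)"
      by simp
    fix f A
    assume f: "f \<in> G \<inter> \<lbrace>\<bottom>..g\<rbrace>" and A: "A \<subseteq> G \<inter> \<lbrace>\<bottom>..g\<rbrace>" "A \<noteq> {}"
      and joins: "\<And>h. h \<in> A \<Longrightarrow> f \<squnion>\<^bsub>lower_interval L g\<^esub> h \<notin> G \<inter> \<lbrace>\<bottom>..g\<rbrace>"
    have "f \<squnion> h \<notin> G" if h: "h \<in> A" for h
    proof -
      have "h \<in> \<lbrace>\<bottom>..g\<rbrace>"
        using h A(1) by blast
      then have "f \<squnion> h \<in> \<lbrace>\<bottom>..g\<rbrace>"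
        using f g by (auto simp: mem_lower_interval intro: join_le)
      moreover have "f \<squnion>\<^bsub>lower_interval L g\<^esub> h = f \<squnion> h"
        using f h A(1) g by (blast intro: join_interval)
      ultimately show ?thesis
        using joins[OF h] by auto
    qed
    then have "\<Squnion>(insert f A) \<notin> G"
      using f A by (intro stable) auto
    moreover have "\<Squnion>\<^bsub>lower_interval L g\<^esub>(insert f A) = \<Squnion>(insert f A)"
      using f A g by (intro sup_interval) auto
    ultimately show "\<Squnion>\<^bsub>lower_interval L g\<^esub>(insert f A) \<notin> G \<inter> \<lbrace>\<bottom>..g\<rbrace>"
      by simp
  qed
qed

text \<open>Joins of elements of an interval stay in it, so compatibility may be computed in \<open>L\<close>. All the
  complexes in question become clique complexes of a single relation and can be compared.\<close>

lemma nested_complex_interval: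
  assumes g: "g \<in> carrier L"
  shows "nested_complex (lower_interval L g) (G \<inter> \<lbrace>\<bottom>..g\<rbrace>)
    = cliques (G \<inter> \<lbrace>\<bottom>..g\<rbrace>) (compatible L G)"
proof -
  interpret I: stable_family "lower_interval L g" "G \<inter> \<lbrace>\<bottom>..g\<rbrace>"
    using g by (rule stable_family_interval)
  show ?thesis
    unfolding I.nested_complex_eq_cliques
  proof (rule cliques_cong)
    fix x y assume xy: "x \<in> G \<inter> \<lbrace>\<bottom>..g\<rbrace>" "y \<in> G \<inter> \<lbrace>\<bottom>..g\<rbrace>"
    then have "x \<squnion> y \<in> \<lbrace>\<bottom>..g\<rbrace>"
      using g by (auto simp: mem_lower_interval intro: join_le)
    then show "compatible (lower_interval L g) (G \<inter> \<lbrace>\<bottom>..g\<rbrace>) x y = compatible L G x y"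
      using xy g by (simp add: compatible_def incomparable_def join_interval)
  qed
qed

end

lemma stable_nestoid_iff: "stable_nestoid L G \<longleftrightarrow> nestoid L G \<and> stable_family L G"
proof (cases "nestoid L G")
  case True
  then have "finite_bounded_lattice L" "G \<subseteq> carrier L"
    unfolding nestoid_def nestable_def by auto
  with True show ?thesis
    unfolding stable_nestoid_def stable_family_def stable_family_axioms_def Ball_def by simp
next
  case False
  then show ?thesis
    unfolding stable_nestoid_def by simp
qed

section \<open>The two families attached to a member of a stable nestoid\<close>

locale stable_nestoid_member = stable_family +
  fixes f
  assumes nestable: "nestable L G"
    and pure: "g \<in> G \<Longrightarrow> pure_complex (nested_complex (lower_interval L g) (G \<inter> \<lbrace>\<bottom>..g\<rbrace>))"
    and member: "f \<in> G"
begin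

lemma carrierG [simp]: "x \<in> G \<Longrightarrow> x \<in> carrier L"
  using family_closed by blast

lemma join_eq_larger: "x \<in> carrier L \<Longrightarrow> y \<in> carrier L \<Longrightarrow> x \<sqsubseteq> y \<Longrightarrow> x \<squnion> y = y"
  by (simp add: le_iff_join[symmetric] le_iff_meet[symmetric])

text \<open>The contrapositive of nestability, with a member of \<open>G\<close> witnessing that the meet is not \<open>\<bottom>\<close>.\<close>

lemma overlapping_join:
  assumes "x \<in> G" "y \<in> G" "z \<in> G" "z \<sqsubseteq> x" "z \<sqsubseteq> y"
  shows "x \<squnion> y \<in> G"
proof (cases "incomparable L x y")
  case True
  have "z \<sqsubseteq> x \<sqinter> y"
    using assms by (simp add: meet_le)
  moreover have "z \<noteq> \<bottom>"
    using nestable assms(3) unfolding nestable_def by blast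
  ultimately have "x \<sqinter> y \<noteq> \<bottom>"
    using assms(3) le_antisym[of z \<bottom>] by auto
  then show ?thesis
    using nestable True assms(1,2) unfolding nestable_def by blast
next
  case False
  then show ?thesis
    using assms join_eq_larger[of x y] join_eq_larger[of y x] join_comm[of L x y]
    by (auto simp: incomparable_def)
qed

lemma floor_iff: "g \<in> G_floor L G f \<longleftrightarrow> g \<in> G \<and> (f \<sqsubseteq> g \<and> f \<noteq> g \<or> f \<squnion> g \<notin> G)"
  unfolding G_floor_def by (auto simp: lless_eq join_comm[of L f])

lemma ceil_eq: "G_ceil L G f = G \<inter> \<lbrace>\<bottom>..f\<rbrace>"
  unfolding G_ceil_def by (auto simp: mem_lower_interval)

lemma floor_not_below: "g \<in> G_floor L G f \<Longrightarrow> \<not> g \<sqsubseteq> f"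
  using member join_eq_larger[of g f] le_antisym[of f g] join_comm[of L f g]
  by (auto simp: floor_iff)

text \<open>If one of \<open>g\<close>, \<open>h\<close> lies strictly above \<open>f\<close>, so does the join. Otherwise both joins with \<open>f\<close> leave \<open>G\<close>, and
  stability at \<open>f\<close> says that \<open>f \<squnion> (g \<squnion> h)\<close> does so too.\<close>

lemma floor_joins:
  assumes g: "g \<in> G_floor L G f" and h: "h \<in> G_floor L G f" and gh: "g \<squnion> h \<in> G"
  shows "g \<squnion> h \<in> G_floor L G f"
proof -
  have G: "g \<in> G" "h \<in> G"
    using g h by (auto simp: floor_iff)
  have le: "g \<sqsubseteq> g \<squnion> h" "h \<sqsubseteq> g \<squnion> h"
    using G by (simp_all add: join_left join_right)
  have above: "g \<squnion> h \<in> G_floor L G f" if x: "x \<in> {g, h}" "f \<sqsubseteq> x" for x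
  proof -
    have xG: "x \<in> G_floor L G f" "x \<in> G" "x \<sqsubseteq> g \<squnion> h"
      using x(1) g h G le by auto
    then have "f \<sqsubseteq> g \<squnion> h"
      using x(2) member G gh le_trans[of f x "g \<squnion> h"] by auto
    moreover have "f \<noteq> g \<squnion> h"
      using floor_not_below[OF xG(1)] xG(3) by metis
    ultimately show ?thesis
      using gh by (simp add: floor_iff)
  qed
  show ?thesis
  proof (cases "f \<sqsubseteq> g \<or> f \<sqsubseteq> h")
    case True
    then show ?thesis
      using above by blast
  next
    case False
    then have "f \<squnion> g \<notin> G" "f \<squnion> h \<notin> G"
      using g h by (auto simp: floor_iff)
    then have "\<Squnion>(insert f {g, h}) \<notin> G"
      using member G by (intro stable) auto
    moreover have "\<Squnion>{f, g, h} = f \<squnion> (g \<squnion> h)"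
      using weak_join_assoc_lemma[of f g h] member G by (simp add: eq_is_equal)
    ultimately show ?thesis
      using gh by (simp add: floor_iff)
  qed
qed

lemma compatible_floor:
  assumes "g \<in> G_floor L G f" "h \<in> G_floor L G f"
  shows "compatible L (G_floor L G f) g h = compatible L G g h"
  using floor_joins[OF assms] by (auto simp: compatible_def floor_iff)

lemma stable_family_floor: "stable_family L (G_floor L G f)"
proof unfold_locales
  show "G_floor L G f \<subseteq> carrier L"
    by (auto simp: floor_iff)
  fix g A
  assume g: "g \<in> G_floor L G f" and A: "A \<subseteq> G_floor L G f" "A \<noteq> {}"
    and joins: "\<And>h. h \<in> A \<Longrightarrow> g \<squnion> h \<notin> G_floor L G f"
  have "g \<squnion> h \<notin> G" if "h \<in> A" for h
    using joins[OF that] floor_joins[OF g] A(1) that by blast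
  then have "\<Squnion>(insert g A) \<notin> G"
    using g A by (intro stable) (auto simp: floor_iff)
  then show "\<Squnion>(insert g A) \<notin> G_floor L G f"
    by (simp add: floor_iff)
qed

text \<open>Suppose that \<open>f \<squnion> b \<notin> G\<close> but \<open>a \<squnion> b \<in> G\<close>. As \<open>f\<close> and \<open>a \<squnion> b\<close> overlap in \<open>a\<close>, their join is in
  \<open>G\<close>; but that join is \<open>f \<squnion> b\<close>.\<close>

lemma ceil_floor_compatible:
  assumes a: "a \<in> G" "a \<sqsubseteq> f" and b: "b \<in> G_floor L G f"
  shows "compatible L G a b"
proof (cases "f \<sqsubseteq> b")
  case True
  then have "a \<sqsubseteq> b"
    using a member b le_trans[of a f b] by (simp add: floor_iff)
  then show ?thesis
    by (simp add: compatible_def incomparable_def)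
next
  case False
  then have bG: "b \<in> G" "f \<squnion> b \<notin> G"
    using b by (auto simp: floor_iff)
  have "a \<squnion> b \<notin> G"
  proof
    assume ab: "a \<squnion> b \<in> G"
    then have "f \<squnion> (a \<squnion> b) \<in> G"
      using a bG member by (intro overlapping_join[of f _ a]) (auto simp: join_left)
    moreover have "f \<squnion> (a \<squnion> b) = f \<squnion> b"
      using a bG member join_eq_larger[of a f] join_comm[of L a f] weak_join_assoc[of f a b]
      by (simp add: eq_is_equal)
    ultimately show False
      using bG(2) by simp
  qed
  then show ?thesis
    by (simp add: compatible_def)
qed

text \<open>The interval below an element \<open>g\<close> above \<open>f\<close> serves two purposes: \<open>g = \<top>\<close> gives the isomorphism,
  and members \<open>g\<close> of the floor family above \<open>f\<close> give its purity there.\<close>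

lemma star_of_member:
  assumes V: "g \<in> carrier L" "f \<sqsubseteq> g"
  shows "vertex_link_join (compatible L G) (G \<inter> \<lbrace>\<bottom>..g\<rbrace>) (G \<inter> \<lbrace>\<bottom>..f\<rbrace>)
    (G_floor L G f \<inter> \<lbrace>\<bottom>..g\<rbrace>) f"
proof
  show "compatible L G y x" if "compatible L G x y" for x y
    using that by (rule compatible_sym)
  show "G \<inter> \<lbrace>\<bottom>..f\<rbrace> \<subseteq> G \<inter> \<lbrace>\<bottom>..g\<rbrace>"
    using V member le_trans[of _ f g] by (auto simp: mem_lower_interval)
  show "G_floor L G f \<inter> \<lbrace>\<bottom>..g\<rbrace> \<subseteq> G \<inter> \<lbrace>\<bottom>..g\<rbrace>"
    by (auto simp: floor_iff)
  show "(G \<inter> \<lbrace>\<bottom>..f\<rbrace>) \<inter> (G_floor L G f \<inter> \<lbrace>\<bottom>..g\<rbrace>) = {}"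
    using floor_not_below by (auto simp: mem_lower_interval)
  show "f \<in> G \<inter> \<lbrace>\<bottom>..f\<rbrace>"
    using member by (simp add: mem_lower_interval)
  show "x \<in> (G \<inter> \<lbrace>\<bottom>..f\<rbrace>) \<union> (G_floor L G f \<inter> \<lbrace>\<bottom>..g\<rbrace>)"
    if "x \<in> G \<inter> \<lbrace>\<bottom>..g\<rbrace>" "x \<noteq> f" "compatible L G f x" for x
    using that by (auto simp: compatible_def incomparable_def floor_iff mem_lower_interval)
  show "compatible L G a b"
    if "a \<in> G \<inter> \<lbrace>\<bottom>..f\<rbrace>" "b \<in> G_floor L G f \<inter> \<lbrace>\<bottom>..g\<rbrace>" for a b
    using that ceil_floor_compatible by (auto simp: mem_lower_interval)
qed

lemma interval_top: "\<lbrace>\<bottom>..\<top>\<rbrace> = carrier L"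
  by (auto simp: mem_lower_interval)

lemma nested_complex_floor_interval:
  assumes "g \<in> carrier L"
  shows "nested_complex (lower_interval L g) (G_floor L G f \<inter> \<lbrace>\<bottom>..g\<rbrace>)
    = cliques (G_floor L G f \<inter> \<lbrace>\<bottom>..g\<rbrace>) (compatible L G)"
proof -
  interpret F: stable_family L "G_floor L G f"
    by (rule stable_family_floor)
  show ?thesis
    unfolding F.nested_complex_interval[OF assms]
    by (rule cliques_cong) (simp add: compatible_floor)
qed

text \<open>No \<open>h \<le> g\<close> in \<open>G\<close> can have \<open>f \<squnion> h \<in> G\<close>: this join would overlap \<open>g\<close> in \<open>h\<close>, forcing
  \<open>f \<squnion> h \<squnion> g = f \<squnion> g\<close> into \<open>G\<close>.\<close>

lemma floor_below_incompatible:
  assumes g: "g \<in> G" "f \<squnion> g \<notin> G"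
  shows "G_floor L G f \<inter> \<lbrace>\<bottom>..g\<rbrace> = G \<inter> \<lbrace>\<bottom>..g\<rbrace>"
proof -
  have "f \<squnion> h \<notin> G" if h: "h \<in> G" "h \<sqsubseteq> g" for h
  proof
    assume fh: "f \<squnion> h \<in> G"
    then have "(f \<squnion> h) \<squnion> g \<in> G"
      using h g member by (intro overlapping_join[of "f \<squnion> h" g h]) (simp_all add: join_right)
    moreover have "(f \<squnion> h) \<squnion> g = f \<squnion> g"
      using h g member join_eq_larger[of h g] weak_join_assoc[of f h g] by (simp add: eq_is_equal)
    ultimately show False
      using g(2) by simp
  qed
  then show ?thesis
    by (auto simp: floor_iff mem_lower_interval)
qed

lemma pure_floor_interval:
  assumes g: "g \<in> G_floor L G f"
  shows "pure_complex (nested_complex (lower_interval L g) (G_floor L G f \<inter> \<lbrace>\<bottom>..g\<rbrace>))"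
proof -
  have gG: "g \<in> G" "g \<in> carrier L"
    using g by (auto simp: floor_iff)
  have pure_g: "pure_complex (cliques (G \<inter> \<lbrace>\<bottom>..g\<rbrace>) (compatible L G))"
    using pure[OF gG(1)] by (simp add: nested_complex_interval gG)
  show ?thesis
    unfolding nested_complex_floor_interval[OF gG(2)]
  proof (cases "f \<sqsubseteq> g")
    case True
    interpret S: vertex_link_join "compatible L G" "G \<inter> \<lbrace>\<bottom>..g\<rbrace>" "G \<inter> \<lbrace>\<bottom>..f\<rbrace>"
      "G_floor L G f \<inter> \<lbrace>\<bottom>..g\<rbrace>" f
      using gG(2) True by (rule star_of_member)
    have "finite (G \<inter> \<lbrace>\<bottom>..g\<rbrace>)"
      using finite_carrier family_closed by (meson finite_Int finite_subset)
    then show "pure_complex (cliques (G_floor L G f \<inter> \<lbrace>\<bottom>..g\<rbrace>) (compatible L G))"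
      using pure_g by (rule S.pure_factor)
  next
    case False
    then have "f \<squnion> g \<notin> G"
      using g by (auto simp: floor_iff)
    then show "pure_complex (cliques (G_floor L G f \<inter> \<lbrace>\<bottom>..g\<rbrace>) (compatible L G))"
      using pure_g floor_below_incompatible[OF gG(1)] by simp
  qed
qed

lemma stable_nestoid_ceil: "stable_nestoid (lower_interval L f) (G_ceil L G f)"
proof -
  have f: "f \<in> carrier L"
    using member by simp
  have "nestable (lower_interval L f) (G \<inter> \<lbrace>\<bottom>..f\<rbrace>)"
    unfolding nestable_def
  proof (intro conjI ballI impI)
    show "G \<inter> \<lbrace>\<bottom>..f\<rbrace> \<subseteq> carrier (lower_interval L f) - {\<bottom>\<^bsub>lower_interval L f\<^esub>}"
      using nestable f by (auto simp: nestable_def bounds_interval)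
    show "\<top>\<^bsub>lower_interval L f\<^esub> \<in> G \<inter> \<lbrace>\<bottom>..f\<rbrace>"
      using member f by (simp add: bounds_interval mem_lower_interval)
    fix x y
    assume xy: "x \<in> G \<inter> \<lbrace>\<bottom>..f\<rbrace>" "y \<in> G \<inter> \<lbrace>\<bottom>..f\<rbrace>" "incomparable (lower_interval L f) x y"
      "x \<squnion>\<^bsub>lower_interval L f\<^esub> y \<notin> G \<inter> \<lbrace>\<bottom>..f\<rbrace>"
    then have "x \<squnion> y \<in> \<lbrace>\<bottom>..f\<rbrace>"
      using f by (auto simp: mem_lower_interval intro: join_le)
    then have "x \<squnion> y \<notin> G"
      using xy f by (simp add: join_interval)
    then have "x \<sqinter> y = \<bottom>"
      using nestable xy by (simp add: nestable_def incomparable_def)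
    then show "x \<sqinter>\<^bsub>lower_interval L f\<^esub> y = \<bottom>\<^bsub>lower_interval L f\<^esub>"
      using xy f by (simp add: meet_interval bounds_interval)
  qed
  moreover have "pure_complex (nested_complex (lower_interval (lower_interval L f) h)
      ((G \<inter> \<lbrace>\<bottom>..f\<rbrace>) \<inter> \<lbrace>\<bottom>\<^bsub>lower_interval L f\<^esub>..h\<rbrace>\<^bsub>lower_interval L f\<^esub>))"
    if h: "h \<in> G \<inter> \<lbrace>\<bottom>..f\<rbrace>" for h
  proof -
    have hf: "h \<in> carrier L" "h \<sqsubseteq> f"
      using h by (auto simp: mem_lower_interval)
    then have "\<lbrace>\<bottom>..f\<rbrace> \<inter> \<lbrace>\<bottom>..h\<rbrace> = \<lbrace>\<bottom>..h\<rbrace>"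
      using f le_trans[of _ h f] by (auto simp: mem_lower_interval)
    then show ?thesis
      using pure[of h] h by (simp add: interval_of_interval[OF f hf] Int_assoc)
  qed
  ultimately have "nestoid (lower_interval L f) (G \<inter> \<lbrace>\<bottom>..f\<rbrace>)"
    using finite_bounded_lattice_interval[OF f] unfolding nestoid_def by blast
  then show ?thesis
    using stable_family_interval[OF f] by (simp add: ceil_eq stable_nestoid_iff)
qed

lemma stable_nestoid_floor:
  assumes "f \<noteq> \<top>"
  shows "stable_nestoid L (G_floor L G f)"
proof -
  have "nestable L (G_floor L G f)"
    unfolding nestable_def
  proof (intro conjI ballI impI)
    show "G_floor L G f \<subseteq> carrier L - {\<bottom>}"
      using nestable by (auto simp: nestable_def floor_iff)
    show "\<top> \<in> G_floor L G f"
      using nestable assms member by (simp add: nestable_def floor_iff)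
    fix g h
    assume gh: "g \<in> G_floor L G f" "h \<in> G_floor L G f" "incomparable L g h"
      "g \<squnion> h \<notin> G_floor L G f"
    then have "g \<squnion> h \<notin> G"
      using floor_joins by blast
    then show "g \<sqinter> h = \<bottom>"
      using gh nestable by (simp add: nestable_def floor_iff)
  qed
  then have "nestoid L (G_floor L G f)"
    using finite_bounded_lattice_axioms pure_floor_interval unfolding nestoid_def by blast
  then show ?thesis
    using stable_family_floor by (simp add: stable_nestoid_iff)
qed

lemma star_decomposition:
  "poset_isomorphic
     {N \<in> nested_complex L G. f \<in> N}
     ({N \<in> nested_complex (lower_interval L f) (G_ceil L G f). f \<in> N}
        \<times> nested_complex L (G_floor L G f))"
proof -
  interpret S: vertex_link_join "compatible L G" "G \<inter> \<lbrace>\<bottom>..\<top>\<rbrace>" "G \<inter> \<lbrace>\<bottom>..f\<rbrace>"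
    "G_floor L G f \<inter> \<lbrace>\<bottom>..\<top>\<rbrace>" f
    using member by (intro star_of_member) auto
  interpret F: stable_family L "G_floor L G f"
    by (rule stable_family_floor)
  have "nested_complex L (G_floor L G f) = cliques (G_floor L G f) (compatible L G)"
    unfolding F.nested_complex_eq_cliques by (rule cliques_cong) (rule compatible_floor)
  then show ?thesis
    using S.star_isomorphic member family_closed F.family_closed
    by (simp add: nested_complex_eq_cliques ceil_eq nested_complex_interval interval_top
        Int_absorb2)
qed

end

theorem lemma2p23:
  fixes L :: "('a, 'b) gorder_scheme" and G :: "'a set" and f :: 'a
  assumes "stable_nestoid L G" and "f \<in> G"
  shows "stable_nestoid (lower_interval L f) (G_ceil L G f)
    \<and> (f \<noteq> \<top>\<^bsub>L\<^esub> \<longrightarrow> stable_nestoid L (G_floor L G f))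
    \<and> poset_isomorphic
        {N \<in> nested_complex L G. f \<in> N}
        ({N \<in> nested_complex (lower_interval L f) (G_ceil L G f). f \<in> N}
           \<times> nested_complex L (G_floor L G f))"
proof -
  interpret stable_nestoid_member L G f
    using assms unfolding stable_nestoid_iff stable_nestoid_member_def
      stable_nestoid_member_axioms_def nestoid_def by simp
  show ?thesis
    using stable_nestoid_ceil stable_nestoid_floor star_decomposition by blast
qed

end
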